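(* As $n\to\infty$, $$(1+o(1))\frac{n}{2}\le g_{\mathrm{ECB}}(n,K_3)\le (1+o(1))\frac{2n}{3}.$$
   Context: Embedded Constructor-Blocker game: the vertices of $K_n$ are placed at the $n$-th roots of unity in the complex plane, and each edge is drawn as the straight chord inside the unit disk between its endpoints. Constructor and Blocker alternately claim previously unclaimed edges, Constructor moving first. Constructor may only claim an edge whose chord does not cross (in an interior point) any chord she has already claimed; Blocker may claim any unclaimed edge. The game ends when Constructor cannot claim any more edges or all edges are claimed. The score is the number of triangles in Constructor's graph at the end; Constructor maximizes it, Blocker minimizes it. $g_{\mathrm{ECB}}(n,K_3)$ denotes the score under optimal play. *)

theory Defs
  imports "HOL-Analysis.Analysis"
begin

definition vtx :: "nat \<Rightarrow> nat \<Rightarrow> complex" where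
  "vtx n k = cis (2 * pi * real k / real n)"

definition ecb_edges :: "nat \<Rightarrow> nat set set" where
  "ecb_edges n = {e. e \<subseteq> {..<n} \<and> card e = 2}"

definition chords_cross :: "nat \<Rightarrow> nat set \<Rightarrow> nat set \<Rightarrow> bool" where
  "chords_cross n e f \<longleftrightarrow> (\<exists>a b c d. e = {a, b} \<and> f = {c, d} \<and>
     open_segment (vtx n a) (vtx n b) \<inter> open_segment (vtx n c) (vtx n d) \<noteq> {})"

text \<open>Unclaimed edges Constructor may legally claim (C: Constructor's edges, B: Blocker's).\<close>
definition legalC :: "nat \<Rightarrow> nat set set \<Rightarrow> nat set set \<Rightarrow> nat set set" where
  "legalC n C B = {e \<in> ecb_edges n - C - B. \<forall>f\<in>C. \<not> chords_cross n e f}"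

definition triangles :: "nat \<Rightarrow> nat set set \<Rightarrow> nat" where
  "triangles n C = card {T. T \<subseteq> {..<n} \<and> card T = 3 \<and>
      (\<forall>e. e \<subseteq> T \<and> card e = 2 \<longrightarrow> e \<in> C)}"

text \<open>Value of the game under optimal play; the first argument k is the number of
  still unclaimed edges (fuel), the boolean says whether it is Constructor's turn.\<close>
fun ecb_val :: "nat \<Rightarrow> nat \<Rightarrow> bool \<Rightarrow> nat set set \<Rightarrow> nat set set \<Rightarrow> nat" where
  "ecb_val n 0 t C B = triangles n C"
| "ecb_val n (Suc k) True C B =
     (if legalC n C B = {} then triangles n C
      else Max ((\<lambda>e. ecb_val n k False (insert e C) B) ` legalC n C B))"
| "ecb_val n (Suc k) False C B =
     (if legalC n C B = {} \<or> ecb_edges n - C - B = {} then triangles n C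
      else Min ((\<lambda>e. ecb_val n k True C (insert e B)) ` (ecb_edges n - C - B)))"

definition g_ECB_K3 :: "nat \<Rightarrow> nat" where
  "g_ECB_K3 n = ecb_val n (card (ecb_edges n)) True {} {}"

end

theory Submission
  imports Defs
begin

text \<open>Two chords cross iff their endpoints interleave. In a noncrossing graph a triangle
  \<open>a < b < c\<close> is determined by its middle vertex \<open>b\<close>, and \<open>b\<close>, \<open>b + 1\<close> are not both middle
  vertices unless the side \<open>{b, b + 1}\<close> is present.

  Upper bound: sweeping along the circle, Blocker takes about \<open>n/3\<close> pairwise disjoint sides, and
  each of them costs Constructor one middle vertex.

  Lower bound: Constructor grows a convex polygon \<open>S\<close> to the right, one vertex per move, while each
  Blocker move spoils at most one unused vertex, so that \<open>S\<close> reaches about \<open>n/2\<close> vertices. Whenever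
  Blocker takes a diagonal of \<open>S\<close>, Constructor answers with a diagonal crossing it; hence no diagonal
  of Blocker obstructs a triangulation of \<open>S\<close>. If Blocker takes the base \<open>{0, m}\<close>, Constructor crosses
  it with an edge from the new vertex to the lowest neighbour of \<open>m\<close>, which leaves one side of \<open>S\<close>
  missing (a gap) but gains a tempo.\<close>

section \<open>Crossing chords\<close>

text \<open>Signed distance of \<open>z\<close> from the line through the two vertices. The unit
  normal has angle \<open>pi * (a + b) / n\<close>, halfway between the endpoints, so for
  \<open>a < b\<close> the positive side contains the vertices strictly between them.\<close>

definition side :: "nat \<Rightarrow> nat \<Rightarrow> nat \<Rightarrow> complex \<Rightarrow> real" where
  "side n a b z = Re z * cos (pi * (real a + real b) / real n)
     + Im z * sin (pi * (real a + real b) / real n) - cos (pi * (real b - real a) / real n)"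

text \<open>By \<open>cos (x + y) - cos (x - y) = - 2 * sin x * sin y\<close>. The sign is then
  visible from the order of \<open>k\<close>, \<open>a\<close> and \<open>b\<close>.\<close>

lemma side_vtx:
  "side n a b (vtx n k) = - 2 * sin (pi * (real k - real a) / n) * sin (pi * (real k - real b) / n)"
proof -
  have "side n a b (vtx n k) = cos (2 * pi * k / n - pi * (real a + real b) / n) - cos (pi * (real b - real a) / n)"
    by (simp add: side_def vtx_def cos_diff)
  also have "2 * pi * k / n - pi * (real a + real b) / n = pi * (real k - real a) / n + pi * (real k - real b) / n"
    by (simp add: field_simps diff_divide_distrib add_divide_distrib)
  also have "pi * (real b - real a) / n = pi * (real k - real a) / n - pi * (real k - real b) / n"
    by (simp add: field_simps diff_divide_distrib add_divide_distrib)
  finally show ?thesis by (simp add: cos_add cos_diff)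
qed

lemma sin_frac_pos:
  assumes "(x::real) > 0" "x < real n" shows "sin (pi * x / n) > 0"
proof (rule sin_gt_zero)
  show "0 < pi * x / n" using assms by simp
  have "pi * x / n = pi * (x / n)" by simp
  also have "\<dots> < pi * 1" by (rule mult_strict_left_mono) (use assms in auto)
  finally show "pi * x / n < pi" by simp
qed

lemma sin_frac_neg:
  assumes "(x::real) < 0" "- x < real n" shows "sin (pi * x / n) < 0"
  using sin_frac_pos[of "-x" n] assms by simp

lemma side_endpoint [simp]: "side n a b (vtx n a) = 0" "side n a b (vtx n b) = 0"
  by (simp_all add: side_vtx)

lemma side_pos:
  assumes "a < k" "k < b" "b < n" shows "side n a b (vtx n k) > 0"
proof -
  have "sin (pi * (real k - real a) / n) > 0" by (rule sin_frac_pos) (use assms in auto)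
  moreover have "sin (pi * (real k - real b) / n) < 0" by (rule sin_frac_neg) (use assms in auto)
  ultimately show ?thesis by (simp add: side_vtx mult_pos_neg)
qed

lemma side_neg:
  assumes "k < a \<or> b < k" "a < b" "b < n" "k < n" shows "side n a b (vtx n k) < 0"
proof -
  consider "k < a" | "b < k" using assms by blast
  then have "sin (pi * (real k - real a) / n) * sin (pi * (real k - real b) / n) > 0"
  proof cases
    case 1
    show ?thesis by (intro mult_neg_neg sin_frac_neg) (use 1 assms in auto)
  next
    case 2
    show ?thesis by (intro mult_pos_pos sin_frac_pos) (use 2 assms in auto)
  qed
  then show ?thesis by (simp add: side_vtx)
qed

lemma side_convex:
  "side n a b ((1 - t) *\<^sub>R x + t *\<^sub>R y) = (1 - t) * side n a b x + t * side n a b y"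
  by (simp add: side_def algebra_simps)

lemma side_segment_zero:
  assumes "z \<in> open_segment (vtx n a) (vtx n b)" shows "side n a b z = 0"
  using assms by (auto simp: in_segment side_convex)

lemma side_segment_pos:
  assumes "z \<in> open_segment x y" "side n a b x \<ge> 0" "side n a b y \<ge> 0" "side n a b x > 0 \<or> side n a b y > 0"
  shows "side n a b z > 0"
proof -
  from assms(1) obtain t where "0 < t" "t < 1" "z = (1 - t) *\<^sub>R x + t *\<^sub>R y"
    by (auto simp: in_segment)
  then show ?thesis using assms(2-)
    by (auto simp: side_convex intro: add_pos_nonneg add_nonneg_pos)
qed

lemma side_segment_neg:
  assumes "z \<in> open_segment x y" "side n a b x \<le> 0" "side n a b y \<le> 0" "side n a b x < 0 \<or> side n a b y < 0"
  shows "side n a b z < 0"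
proof -
  from assms(1) obtain t where "0 < t" "t < 1" "z = (1 - t) *\<^sub>R x + t *\<^sub>R y"
    by (auto simp: in_segment)
  moreover from this assms(2,3) have "(1 - t) * side n a b x \<le> 0" "t * side n a b y \<le> 0"
    by (auto intro: mult_nonneg_nonpos)
  moreover from calculation assms(4) have "(1 - t) * side n a b x < 0 \<or> t * side n a b y < 0"
    by (auto intro: mult_pos_neg)
  ultimately show ?thesis by (auto simp: side_convex)
qed

lemma chords_cross_iff_segments:
  "chords_cross n {a, b} {c, d} \<longleftrightarrow>
     open_segment (vtx n a) (vtx n b) \<inter> open_segment (vtx n c) (vtx n d) \<noteq> {}"
  (is "?L \<longleftrightarrow> ?R")
proof
  show "?R \<Longrightarrow> ?L" unfolding chords_cross_def by blast
  assume ?L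
  then obtain a' b' c' d' where "{a, b} = {a', b'}" "{c, d} = {c', d'}"
    and ne: "open_segment (vtx n a') (vtx n b') \<inter> open_segment (vtx n c') (vtx n d') \<noteq> {}"
    unfolding chords_cross_def by blast
  then have "open_segment (vtx n a) (vtx n b) = open_segment (vtx n a') (vtx n b')"
    "open_segment (vtx n c) (vtx n d) = open_segment (vtx n c') (vtx n d')"
    unfolding doubleton_eq_iff by (auto simp: open_segment_commute)
  with ne show ?R by (simp only:) simp
qed

text \<open>Without interleaving, \<open>c\<close> and \<open>d\<close> lie weakly on one side of
  the line through \<open>a\<close> and \<open>b\<close>, and one of them strictly because the
  chords differ. The open segment between them therefore misses that line.\<close>

lemma not_chords_cross:
  assumes "a < b" "b < n" "c < d" "d < n" "{a, b} \<noteq> {c, d}"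
    and "\<not> (a < c \<and> c < b \<and> b < d)" "\<not> (c < a \<and> a < d \<and> d < b)"
  shows "\<not> chords_cross n {a, b} {c, d}"
proof -
  have ncd: "side n a b z \<noteq> 0" if z: "z \<in> open_segment (vtx n c) (vtx n d)" for z
  proof (cases "a \<le> c \<and> d \<le> b")
    case True
    have "side n a b (vtx n k) \<ge> 0" if "a \<le> k" "k \<le> b" for k
      using side_pos[of a k b n] that assms by (cases "k = a"; cases "k = b") auto
    moreover have "a < c \<or> d < b" using True assms by (metis le_neq_implies_less)
    then have "side n a b (vtx n c) > 0 \<or> side n a b (vtx n d) > 0"
      using side_pos[of a c b n] side_pos[of a d b n] assms True by linarith
    ultimately show ?thesis using side_segment_pos[OF z, of n a b] True assms by force
  next
    case False
    have "side n a b (vtx n k) \<le> 0" if "k \<le> a \<or> b \<le> k" "k < n" for k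
      using side_neg[of k a b n] that assms by (cases "k = a"; cases "k = b") auto
    moreover have "c < a \<or> b < c \<or> d < a \<or> b < d" using False by auto
    then have "side n a b (vtx n c) < 0 \<or> side n a b (vtx n d) < 0"
      using side_neg[of c a b n] side_neg[of d a b n] assms by fastforce
    moreover have "(c \<le> a \<or> b \<le> c) \<and> (d \<le> a \<or> b \<le> d)" using False assms by linarith
    ultimately show ?thesis using side_segment_neg[OF z, of n a b] assms by force
  qed
  then show ?thesis unfolding chords_cross_iff_segments using side_segment_zero by blast
qed

lemma side_zero_on_segment:
  assumes "side n a b x > 0" "side n a b y < 0"
  obtains z where "z \<in> open_segment x y" "side n a b z = 0"
proof -
  define t where "t = side n a b x / (side n a b x - side n a b y)"
  have t: "0 < t" "t < 1" using assms by (auto simp: t_def field_simps)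
  have "x \<noteq> y" using assms by auto
  then have "(1 - t) *\<^sub>R x + t *\<^sub>R y \<in> open_segment x y" using t by (auto simp: in_segment)
  moreover have "side n a b ((1 - t) *\<^sub>R x + t *\<^sub>R y) = 0"
    unfolding side_convex t_def using assms by (simp add: field_simps)
  ultimately show ?thesis by (rule that)
qed

text \<open>Each open segment meets the line of the other chord. The two lines are not parallel, so
  both meeting points are the common point of the lines.\<close>

lemma chords_cross_interleaved:
  assumes "a < c" "c < b" "b < d" "d < n"
  shows "chords_cross n {a, b} {c, d}"
proof -
  obtain z where z: "z \<in> open_segment (vtx n c) (vtx n d)" "side n a b z = 0"
    using side_zero_on_segment[OF side_pos[of a c b n] side_neg[of d a b n]] assms by auto
  obtain w where w: "w \<in> open_segment (vtx n b) (vtx n a)" "side n c d w = 0"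
    using side_zero_on_segment[OF side_pos[of c b d n] side_neg[of a c d n]] assms by auto
  have w0: "side n a b w = 0" using w(1) side_segment_zero open_segment_commute by metis
  have z0: "side n c d z = 0" using z(1) side_segment_zero by blast
  \<comment> \<open>The difference \<open>(u, v)\<close> of the two points is orthogonal to both
    normals, whose angles differ by a value strictly between 0 and \<open>pi\<close>.\<close>
  define \<alpha> \<beta> where "\<alpha> = pi * (real a + real b) / n" and "\<beta> = pi * (real c + real d) / n"
  define u v where "u = Re z - Re w" and "v = Im z - Im w"
  have e1: "u * cos \<alpha> + v * sin \<alpha> = 0" and e2: "u * cos \<beta> + v * sin \<beta> = 0"
    using z(2) w(2) w0 z0 unfolding side_def \<alpha>_def \<beta>_def u_def v_def by (simp_all add: algebra_simps)
  have "\<beta> - \<alpha> = pi * (real c + real d - real a - real b) / n"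
    by (simp add: \<alpha>_def \<beta>_def field_simps diff_divide_distrib add_divide_distrib)
  then have "sin (\<beta> - \<alpha>) > 0"
    using sin_frac_pos[of "real c + real d - real a - real b" n] assms by simp
  then have det: "sin \<beta> * cos \<alpha> - cos \<beta> * sin \<alpha> > 0" by (simp add: sin_diff)
  have "u * (sin \<beta> * cos \<alpha> - cos \<beta> * sin \<alpha>)
      = (u * cos \<alpha> + v * sin \<alpha>) * sin \<beta> - (u * cos \<beta> + v * sin \<beta>) * sin \<alpha>"
    "v * (sin \<beta> * cos \<alpha> - cos \<beta> * sin \<alpha>)
      = (u * cos \<beta> + v * sin \<beta>) * cos \<alpha> - (u * cos \<alpha> + v * sin \<alpha>) * cos \<beta>"
    by (simp_all add: algebra_simps)
  then have "u = 0" "v = 0" using e1 e2 det by auto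
  then have "z = w" by (simp add: u_def v_def complex_eq_iff)
  then show ?thesis unfolding chords_cross_iff_segments
    using z(1) w(1) open_segment_commute by blast
qed

section \<open>Noncrossing graphs in terms of interleaving endpoints\<close>

definition noncrossing :: "nat set set \<Rightarrow> bool" where
  "noncrossing C \<longleftrightarrow> (\<forall>a b c d. {a, b} \<in> C \<longrightarrow> {c, d} \<in> C \<longrightarrow> \<not> (a < c \<and> c < b \<and> b < d))"

text \<open>The chord need not belong to \<open>C\<close>, so both interleaving patterns are listed;
  \<open>noncrossing\<close> gets the second from the first by exchanging its two edges.\<close>

definition uncrossed :: "nat set set \<Rightarrow> nat \<Rightarrow> nat \<Rightarrow> bool" where
  "uncrossed C a b \<longleftrightarrow>
     (\<forall>c d. {c, d} \<in> C \<longrightarrow> \<not> (a < c \<and> c < b \<and> b < d) \<and> \<not> (c < a \<and> a < d \<and> d < b))"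

lemma noncrossingD:
  "noncrossing C \<Longrightarrow> {a, b} \<in> C \<Longrightarrow> {c, d} \<in> C \<Longrightarrow> a < c \<Longrightarrow> c < b \<Longrightarrow> b < d \<Longrightarrow> False"
  unfolding noncrossing_def by blast

lemma ecb_edgesE:
  assumes "e \<in> ecb_edges n"
  obtains a b where "e = {a, b}" "a < b" "b < n"
proof -
  from assms obtain a b where "e = {a, b}" "a \<noteq> b" "a < n" "b < n"
    unfolding ecb_edges_def card_2_iff by auto
  then show ?thesis using that[of a b] that[of b a] by (cases "a < b") (auto simp: insert_commute)
qed

lemma pair_in_ecb_edges_iff: "{a, b} \<in> ecb_edges n \<longleftrightarrow> a \<noteq> b \<and> a < n \<and> b < n"
  by (auto simp: ecb_edges_def card_2_iff doubleton_eq_iff)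

lemma finite_ecb_edges [simp]: "finite (ecb_edges n)"
  by (rule finite_subset[of _ "Pow {..<n}"]) (auto simp: ecb_edges_def)

lemma finite_legalC [simp]: "finite (legalC n C B)"
  by (rule finite_subset[OF _ finite_ecb_edges[of n]]) (auto simp: legalC_def)

lemma chords_cross_commute: "chords_cross n e f \<longleftrightarrow> chords_cross n f e"
  unfolding chords_cross_def by (metis Int_commute)

lemma legalC_uncrossedI:
  assumes "C \<subseteq> ecb_edges n" "x < y" "y < n" "{x, y} \<notin> C" "{x, y} \<notin> B" "uncrossed C x y"
  shows "{x, y} \<in> legalC n C B"
proof -
  have "\<not> chords_cross n {x, y} f" if f: "f \<in> C" for f
  proof -
    obtain c d where cd: "f = {c, d}" "c < d" "d < n" using ecb_edgesE assms(1) f by blast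
    show ?thesis unfolding cd(1)
      by (rule not_chords_cross) (use assms cd f in \<open>auto simp: uncrossed_def\<close>)
  qed
  then show ?thesis using assms unfolding legalC_def by (auto simp: pair_in_ecb_edges_iff)
qed

lemma noncrossing_insert:
  assumes "noncrossing C" "x < y" "uncrossed C x y"
  shows "noncrossing (insert {x, y} C)"
  using assms unfolding noncrossing_def uncrossed_def by (auto simp: doubleton_eq_iff)

lemma uncrossed_if_legalC:
  assumes "C \<subseteq> ecb_edges n" "{x, y} \<in> legalC n C B" "x < y"
  shows "uncrossed C x y"
proof -
  have "y < n" using assms by (auto simp: legalC_def pair_in_ecb_edges_iff)
  have "\<not> (x < c \<and> c < y \<and> y < d) \<and> \<not> (c < x \<and> x < d \<and> d < y)" if cd: "{c, d} \<in> C" for c d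
  proof -
    have "c < n" "d < n" using assms(1) cd pair_in_ecb_edges_iff by blast+
    moreover have "\<not> chords_cross n {x, y} {c, d}" using assms(2) cd by (auto simp: legalC_def)
    ultimately show ?thesis
      using chords_cross_interleaved[of x c y d n] chords_cross_interleaved[of c x d y n]
        chords_cross_commute \<open>y < n\<close> by blast
  qed
  then show ?thesis unfolding uncrossed_def by blast
qed

lemma noncrossing_insert_legalC:
  assumes "C \<subseteq> ecb_edges n" "noncrossing C" "e \<in> legalC n C B"
  shows "noncrossing (insert e C)"
proof -
  have "e \<in> ecb_edges n" using assms by (auto simp: legalC_def)
  then obtain x y where "e = {x, y}" "x < y" by (rule ecb_edgesE)
  then show ?thesis using noncrossing_insert uncrossed_if_legalC assms by blast
qed

section \<open>Middle vertices and Blocker's strategy\<close>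

definition middle :: "nat set set \<Rightarrow> nat \<Rightarrow> bool" where
  "middle C b \<longleftrightarrow> (\<exists>a c. a < b \<and> b < c \<and> {a, b} \<in> C \<and> {b, c} \<in> C \<and> {a, c} \<in> C)"

lemma middle_less:
  assumes "C \<subseteq> ecb_edges n" "middle C b" shows "b < n"
  using assms unfolding middle_def by (meson pair_in_ecb_edges_iff subsetD)

lemma card_3_sorted:
  assumes "card (T :: nat set) = 3"
  obtains a b c where "T = {a, b, c}" "a < b" "b < c"
proof -
  have fin: "finite T" using assms by (intro card_ge_0_finite) auto
  define xs where "xs = sorted_list_of_set T"
  have "length xs = 3" "sorted_wrt (<) xs" "set xs = T" using assms fin by (auto simp: xs_def)
  then obtain a b c where "xs = [a, b, c]" by (auto simp: numeral_3_eq_3 length_Suc_conv)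
  then show ?thesis using that \<open>sorted_wrt (<) xs\<close> \<open>set xs = T\<close> by auto
qed

text \<open>If two triangles share their middle vertex but differ elsewhere, the long side of one
  crosses a short side of the other.\<close>

lemma triangles_le_card_middle:
  assumes C: "C \<subseteq> ecb_edges n" "noncrossing C"
  shows "triangles n C \<le> card {b. middle C b}"
proof -
  define tri where "tri a b c \<longleftrightarrow> a < b \<and> b < c \<and> {a, b} \<in> C \<and> {b, c} \<in> C \<and> {a, c} \<in> C" for a b c
  \<comment> \<open>The union of all triangles with middle vertex \<open>b\<close>; by
    \<open>uniq\<close> there is at most one.\<close>
  define h where "h b = {x. \<exists>a c. tri a b c \<and> x \<in> {a, b, c}}" for b
  have uniq: "a = a' \<and> c = c'" if "tri a b c" "tri a' b c'" for a b c a' c'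
  proof -
    note N = noncrossingD[OF C(2)]
    have "\<not> a < a'" using N[of a b a' c'] that by (auto simp: tri_def)
    moreover have "\<not> a' < a" using N[of a' b a c] that by (auto simp: tri_def)
    moreover have "\<not> c < c'" using N[of a c b c'] that by (auto simp: tri_def)
    moreover have "\<not> c' < c" using N[of a' c' b c] that by (auto simp: tri_def)
    ultimately show ?thesis by auto
  qed
  have "{T. T \<subseteq> {..<n} \<and> card T = 3 \<and> (\<forall>e. e \<subseteq> T \<and> card e = 2 \<longrightarrow> e \<in> C)} \<subseteq> h ` {b. middle C b}"
  proof clarify
    fix T assume "card T = 3" and T: "\<forall>e. e \<subseteq> T \<and> card e = 2 \<longrightarrow> e \<in> C"
    then obtain a b c where abc: "T = {a, b, c}" "a < b" "b < c" by (metis card_3_sorted)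
    have "tri a b c" unfolding tri_def using T abc by auto
    moreover from this have "h b = T" unfolding h_def abc(1) using uniq by blast
    ultimately show "T \<in> h ` {b. middle C b}" unfolding tri_def middle_def by blast
  qed
  moreover have "finite {b. middle C b}"
    by (rule finite_subset[of _ "{..<n}"]) (use middle_less[OF C(1)] in auto)
  ultimately show ?thesis unfolding triangles_def by (rule surj_card_le[rotated])
qed

text \<open>With the side missing, an upper neighbour \<open>c\<close> of \<open>b\<close> and a
  lower neighbour \<open>a\<close> of \<open>Suc b\<close> satisfy \<open>a < b < Suc b < c\<close>,
  so these two edges cross.\<close>

lemma not_both_middle:
  assumes "noncrossing C" "{b, Suc b} \<notin> C" "middle C b" "middle C (Suc b)"
  shows False
proof -
  obtain c where c: "b < c" "{b, c} \<in> C" using assms(3) by (auto simp: middle_def)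
  obtain a where a: "a < Suc b" "{a, Suc b} \<in> C" using assms(4) by (auto simp: middle_def)
  have "a \<noteq> b" "c \<noteq> Suc b" using a c assms(2) by auto
  then show False using noncrossingD[OF assms(1) a(2) c(2)] a(1) c(1) by linarith
qed

section \<open>Disjoint sides taken by Blocker\<close>

definition sparse_sides :: "nat \<Rightarrow> nat set set \<Rightarrow> nat set \<Rightarrow> bool" where
  "sparse_sides n B P \<longleftrightarrow> (\<forall>b\<in>P. Suc b < n \<and> {b, Suc b} \<in> B \<and> Suc b \<notin> P)"

lemma triangles_plus_sparse_sides:
  assumes C: "C \<subseteq> ecb_edges n" "noncrossing C" and "C \<inter> B = {}" and P: "sparse_sides n B P"
  shows "triangles n C + card P \<le> n"
proof -
  define M where "M = {b. middle C b}"
  have M: "M \<subseteq> {..<n}" using middle_less[OF C(1)] by (auto simp: M_def)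
  \<comment> \<open>An end of the blocked side at \<open>b\<close> that is not a middle vertex.
    Disjoint sides yield different ends.\<close>
  define h where "h b = (if b \<in> M then Suc b else b)" for b
  have "h ` P \<subseteq> {..<n} - M"
  proof clarify
    fix b assume b: "b \<in> P"
    then have "{b, Suc b} \<notin> C" "Suc b < n" using P assms(3) by (auto simp: sparse_sides_def)
    then show "h b \<in> {..<n} - M" using not_both_middle[OF C(2), of b] by (auto simp: h_def M_def)
  qed
  moreover have "inj_on h P"
    using P by (auto simp: inj_on_def h_def sparse_sides_def split: if_splits)
  ultimately have "card P \<le> card ({..<n} - M)" by (intro card_inj_on_le) auto
  also have "\<dots> = n - card M" using M by (simp add: card_Diff_subset finite_subset)
  finally have "card P \<le> n - card M" .
  moreover have "card M \<le> n" using M by (metis card_lessThan card_mono finite_lessThan)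
  moreover have "triangles n C \<le> card M" using triangles_le_card_middle[OF C] by (simp add: M_def)
  ultimately show ?thesis by linarith
qed

text \<open>The target of Blocker's strategy: together with
  \<open>triangles n C + card P \<le> n\<close> the last inequality gives
  \<open>3 * triangles n C \<le> 3 * n - (n - 2)\<close>.\<close>

definition sides_secured :: "nat \<Rightarrow> nat set set \<Rightarrow> nat set set \<Rightarrow> bool" where
  "sides_secured n C B \<longleftrightarrow> C \<subseteq> ecb_edges n \<and> noncrossing C \<and> C \<inter> B = {} \<and>
     (\<exists>P. sparse_sides n B P \<and> n \<le> 3 * card P + 2)"

lemma sides_secured_triangles:
  assumes "sides_secured n C B" shows "3 * triangles n C \<le> 2 * n + 2"
  using assms triangles_plus_sparse_sides[of C n B] unfolding sides_secured_def by fastforce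

text \<open>Every legal move of either player preserves the condition, so from here on Blocker may
  play arbitrarily.\<close>

lemma ecb_val_sides_secured:
  assumes "sides_secured n C B"
  shows "3 * ecb_val n k t C B \<le> 2 * n + 2"
  using assms
proof (induction k arbitrary: t C B)
  case 0
  then show ?case using sides_secured_triangles by simp
next
  case (Suc k)
  note tri = sides_secured_triangles[OF Suc.prems]
  show ?case
  proof (cases t)
    case True
    show ?thesis
    proof (cases "legalC n C B = {}")
      case False
      define A where "A = (\<lambda>e. ecb_val n k False (insert e C) B) ` legalC n C B"
      have "Max A \<in> A" unfolding A_def using False by (intro Max_in) auto
      then obtain e where e: "e \<in> legalC n C B" "Max A = ecb_val n k False (insert e C) B"
        by (auto simp: A_def)
      have "sides_secured n (insert e C) B"
        using Suc.prems noncrossing_insert_legalC[of C n e B] e(1)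
        unfolding sides_secured_def by (auto simp: legalC_def)
      from Suc.IH[OF this, of False] show ?thesis using False True e(2) by (simp add: A_def)
    qed (use True tri in simp)
  next
    case F: False
    show ?thesis
    proof (cases "legalC n C B = {} \<or> ecb_edges n - C - B = {}")
      case False
      then obtain f where f: "f \<in> ecb_edges n - C - B" by blast
      have "sides_secured n C (insert f B)"
        using Suc.prems f unfolding sides_secured_def sparse_sides_def by blast
      from Suc.IH[OF this, of True]
      have "3 * ecb_val n k True C (insert f B) \<le> 2 * n + 2" .
      moreover have "Min ((\<lambda>e. ecb_val n k True C (insert e B)) ` (ecb_edges n - C - B))
          \<le> ecb_val n k True C (insert f B)" using f by (intro Min_le) auto
      ultimately show ?thesis using False F by simp
    qed (use F tri in simp)
  qed
qed

section \<open>Blocker's sweep along the circle\<close>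

text \<open>The sides below index \<open>j\<close> are settled, \<open>P\<close> indexes the ones Blocker took, and
  Constructor's sides at or above \<open>j\<close> are charged in advance. The slack \<open>s\<close> is
  \<open>0\<close> when Constructor is to move and \<open>1\<close> when Blocker is to move.\<close>
definition sweep :: "nat \<Rightarrow> nat \<Rightarrow> nat \<Rightarrow> nat set \<Rightarrow> nat set set \<Rightarrow> nat set set \<Rightarrow> bool" where
  "sweep n s j P C B \<longleftrightarrow> C \<subseteq> ecb_edges n \<and> noncrossing C \<and> C \<inter> B = {} \<and>
     sparse_sides n B P \<and> (\<forall>b\<in>P. Suc b < j) \<and> (\<forall>b\<ge>j. {b, Suc b} \<notin> B) \<and>
     j + card {b. j \<le> b \<and> {b, Suc b} \<in> C} \<le> 3 * card P + s"

lemma finite_side_indices: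
  assumes "C \<subseteq> ecb_edges n" shows "finite {b. j \<le> b \<and> {b, Suc b} \<in> C}"
  by (rule finite_subset[of _ "{..<n}"]) (use assms pair_in_ecb_edges_iff in auto)

lemma pair_Suc_eq_iff: "{a, Suc a} = {b, Suc b} \<longleftrightarrow> a = b"
  by (auto simp: doubleton_eq_iff)

text \<open>All remaining sides up to \<open>{n - 2, n - 1}\<close> are already charged, so
  \<open>n - 1 \<le> 3 * card P + 1\<close>.\<close>

lemma sweep_exhausted:
  assumes S: "sweep n s j P C B" "s \<le> 1"
    and all: "\<And>b. j \<le> b \<Longrightarrow> Suc b < n \<Longrightarrow> {b, Suc b} \<in> C"
  shows "sides_secured n C B"
proof -
  have "card {j..<n - 1} \<le> card {b. j \<le> b \<and> {b, Suc b} \<in> C}"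
    by (rule card_mono) (use S(1) finite_side_indices[of C n j] all in \<open>auto simp: sweep_def\<close>)
  then have "n - 1 - j \<le> card {b. j \<le> b \<and> {b, Suc b} \<in> C}" by simp
  then have "n \<le> 3 * card P + 2" using S unfolding sweep_def by linarith
  then show ?thesis using S(1) unfolding sweep_def sides_secured_def by blast
qed

text \<open>No vertex lies strictly between the ends of a side, so nothing crosses it. An unclaimed
  side would still be legal for Constructor.\<close>

lemma sweep_no_legal_sides:
  assumes S: "sweep n s j P C B" "s \<le> 1" and "legalC n C B = {}"
  shows "sides_secured n C B"
proof (rule sweep_exhausted[OF S])
  fix b assume b: "j \<le> b" "Suc b < n"
  show "{b, Suc b} \<in> C"
  proof (rule ccontr)
    assume "{b, Suc b} \<notin> C"
    moreover have "uncrossed C b (Suc b)" by (auto simp: uncrossed_def)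
    ultimately have "{b, Suc b} \<in> legalC n C B"
      using S(1) b by (intro legalC_uncrossedI) (auto simp: sweep_def)
    then show False using assms by auto
  qed
qed

text \<open>The new edge is at most one side, so the advance charge grows by at most one, which the
  slack absorbs.\<close>

lemma sweep_Constructor_move:
  assumes S: "sweep n 0 j P C B" and e: "e \<in> legalC n C B"
  shows "sweep n 1 j P (insert e C) B"
proof -
  define Q where "Q C = {b. j \<le> b \<and> {b, Suc b} \<in> C}" for C
  have C: "C \<subseteq> ecb_edges n" "noncrossing C" using S by (auto simp: sweep_def)
  have "card (Q (insert e C)) \<le> Suc (card (Q C))"
  proof (cases "\<exists>b. e = {b, Suc b}")
    case True
    then obtain b where "e = {b, Suc b}" by blast
    then have "Q (insert e C) \<subseteq> insert b (Q C)" by (auto simp: Q_def pair_Suc_eq_iff)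
    then have "card (Q (insert e C)) \<le> card (insert b (Q C))"
      using finite_side_indices[OF C(1), of j] by (intro card_mono) (auto simp: Q_def)
    also have "\<dots> \<le> Suc (card (Q C))"
      using finite_side_indices[OF C(1), of j] by (simp add: card_insert_if Q_def)
    finally show ?thesis .
  next
    case False
    then have "Q (insert e C) = Q C" by (auto simp: Q_def)
    then show ?thesis by simp
  qed
  moreover have "insert e C \<subseteq> ecb_edges n" "e \<notin> B" using C e by (auto simp: legalC_def)
  ultimately show ?thesis
    using S noncrossing_insert_legalC[OF C e] unfolding sweep_def Q_def by auto
qed

text \<open>The skipped sides below \<open>b\<close> were charged in advance. Settling the indices
  \<open>b\<close> and \<open>b + 1\<close> costs two and the slack costs one; the new element of
  \<open>P\<close> pays exactly three. Index \<open>b + 1\<close> is given up to keep Blocker's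
  sides disjoint.\<close>

lemma sweep_Blocker_move:
  assumes S: "sweep n 1 j P C B"
    and b: "j \<le> b" "Suc b < n" "{b, Suc b} \<notin> C"
    and below: "\<And>i. j \<le> i \<Longrightarrow> i < b \<Longrightarrow> {i, Suc i} \<in> C"
  shows "sweep n 0 (b + 2) (insert b P) C (insert {b, Suc b} B)"
proof -
  have C: "C \<subseteq> ecb_edges n" and P: "\<And>i. i \<in> P \<Longrightarrow> Suc i < j" using S by (auto simp: sweep_def)
  have finP: "finite P" by (rule finite_subset[of _ "{..<j}"]) (use P in force)+
  have "b \<notin> P" using P b by force
  define Q where "Q = {i. b + 2 \<le> i \<and> {i, Suc i} \<in> C}"
  have "card ({j..<b} \<union> Q) \<le> card {i. j \<le> i \<and> {i, Suc i} \<in> C}"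
    by (rule card_mono[OF finite_side_indices[OF C]]) (use b below in \<open>auto simp: Q_def\<close>)
  moreover have "card ({j..<b} \<union> Q) = b - j + card Q"
    using finite_side_indices[OF C, of "b + 2"] by (subst card_Un_disjoint) (auto simp: Q_def)
  moreover have "card (insert b P) = Suc (card P)" using \<open>b \<notin> P\<close> finP by simp
  ultimately have "b + 2 + card Q \<le> 3 * card (insert b P)"
    using S b unfolding sweep_def by linarith
  moreover have "sparse_sides n (insert {b, Suc b} B) (insert b P)"
    using S b P unfolding sweep_def sparse_sides_def by fastforce
  moreover have "\<forall>i\<in>insert b P. Suc i < b + 2" using P b by fastforce
  moreover have "\<forall>i\<ge>b + 2. {i, Suc i} \<notin> insert {b, Suc b} B"
    using S b unfolding sweep_def by (auto simp: pair_Suc_eq_iff)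
  ultimately show ?thesis using S b(3) unfolding sweep_def Q_def by simp
qed

text \<open>Induction over rounds: any Constructor move, then Blocker's answer. The fuel equals the
  number of unclaimed edges, so it cannot run out while a move is available.\<close>

lemma ecb_val_sweep:
  assumes "sweep n 0 j P C B" "k = card (ecb_edges n - C - B)"
  shows "3 * ecb_val n k True C B \<le> 2 * n + 2"
  using assms
proof (induction k arbitrary: j P C B rule: less_induct)
  case (less k)
  show ?case
  proof (cases "legalC n C B = {}")
    case True
    then show ?thesis using ecb_val_sides_secured sweep_no_legal_sides less.prems(1) by blast
  next
    case False
    then have "ecb_edges n - C - B \<noteq> {}" by (auto simp: legalC_def)
    then have "k \<noteq> 0" using less.prems(2) by simp
    then obtain k1 where k1: "k = Suc k1" using not0_implies_Suc by blast
    define A where "A = (\<lambda>e. ecb_val n k1 False (insert e C) B) ` legalC n C B"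
    have "Max A \<in> A" unfolding A_def using False by (intro Max_in) auto
    then obtain e where e: "e \<in> legalC n C B" "Max A = ecb_val n k1 False (insert e C) B"
      by (auto simp: A_def)
    have val: "ecb_val n k True C B = ecb_val n k1 False (insert e C) B"
      using False e(2) by (simp add: k1 A_def)
    note S = sweep_Constructor_move[OF less.prems(1) e(1)]
    have e': "e \<in> ecb_edges n - C - B" using e(1) by (auto simp: legalC_def)
    have "ecb_edges n - insert e C - B = (ecb_edges n - C - B) - {e}" by auto
    then have k1_card: "k1 = card (ecb_edges n - insert e C - B)"
      using less.prems(2) e' by (simp add: k1)
    show ?thesis
    proof (cases "\<exists>b\<ge>j. Suc b < n \<and> {b, Suc b} \<notin> insert e C")
      case False
      then have "sides_secured n (insert e C) B" using sweep_exhausted[OF S] by auto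
      then show ?thesis using ecb_val_sides_secured val by metis
    next
      case ex: True
      \<comment> \<open>Blocker answers with the first side from \<open>j\<close> on that
        Constructor does not own.\<close>
      define b where "b = (LEAST b. j \<le> b \<and> Suc b < n \<and> {b, Suc b} \<notin> insert e C)"
      have b: "j \<le> b" "Suc b < n" "{b, Suc b} \<notin> insert e C"
        using LeastI_ex[OF ex] unfolding b_def by auto
      have "{i, Suc i} \<in> insert e C" if "j \<le> i" "i < b" for i
        using not_less_Least[of i "\<lambda>b. j \<le> b \<and> Suc b < n \<and> {b, Suc b} \<notin> insert e C"] that b(2)
        unfolding b_def[symmetric] by auto
      note S' = sweep_Blocker_move[OF S b this]
      have f: "{b, Suc b} \<in> ecb_edges n - insert e C - B"
        using b S by (auto simp: sweep_def pair_in_ecb_edges_iff)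
      then have "k1 \<noteq> 0" using k1_card by auto
      then obtain k2 where k2: "k1 = Suc k2" using not0_implies_Suc by blast
      show ?thesis
      proof (cases "legalC n (insert e C) B = {}")
        case True
        then have "sides_secured n (insert e C) B" using sweep_no_legal_sides[OF S] by auto
        then show ?thesis using ecb_val_sides_secured val by metis
      next
        case False
        have "ecb_edges n - insert e C - insert {b, Suc b} B
            = (ecb_edges n - insert e C - B) - {{b, Suc b}}" by auto
        then have "k2 = card (ecb_edges n - insert e C - insert {b, Suc b} B)"
          using k1_card f k2 by simp
        from less.IH[OF _ S' this]
        have "3 * ecb_val n k2 True (insert e C) (insert {b, Suc b} B) \<le> 2 * n + 2"
          by (simp add: k1 k2)
        moreover have "ecb_val n k1 False (insert e C) B
            \<le> ecb_val n k2 True (insert e C) (insert {b, Suc b} B)"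
          using False f by (auto simp: k2 intro!: Min_le)
        ultimately show ?thesis using val by linarith
      qed
    qed
  qed
qed

lemma g_ECB_K3_upper: "3 * g_ECB_K3 n \<le> 2 * n + 2"
  unfolding g_ECB_K3_def
  by (rule ecb_val_sweep[of n 0 "{}"]) (auto simp: sweep_def noncrossing_def sparse_sides_def)

section \<open>Constructor's strategy\<close>

lemma triangles_insert: "triangles n C \<le> triangles n (insert e C)"
  unfolding triangles_def by (rule card_mono) (auto intro: finite_subset[of _ "Pow {..<n}"])

text \<open>Triangles are never lost, so the analysis may stop as soon as Constructor has enough of
  them.\<close>

lemma triangles_le_ecb_val: "triangles n C \<le> ecb_val n k t C B"
proof (induction k arbitrary: t C B)
  case (Suc k)
  show ?case
  proof (cases t)
    case True
    show ?thesis
    proof (cases "legalC n C B = {}")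
      case False
      then obtain e where e: "e \<in> legalC n C B" by blast
      have "triangles n C \<le> ecb_val n k False (insert e C) B"
        using Suc.IH triangles_insert le_trans by blast
      also have "\<dots> \<le> Max ((\<lambda>e. ecb_val n k False (insert e C) B) ` legalC n C B)"
        using e by (intro Max_ge) auto
      finally show ?thesis using True False by simp
    qed (use True in simp)
  next
    case F: False
    show ?thesis
    proof (cases "legalC n C B = {} \<or> ecb_edges n - C - B = {}")
      case False
      then have "triangles n C \<le> Min ((\<lambda>e. ecb_val n k True C (insert e B)) ` (ecb_edges n - C - B))"
        using Suc.IH by (subst Min_ge_iff) auto
      then show ?thesis using F False by simp
    qed (use F in auto)
  qed
qed simp

text \<open>Each triangle has only one middle vertex, so selecting a triangle for every middle
  vertex is injective.\<close>

lemma card_middle_le_triangles: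
  assumes "C \<subseteq> ecb_edges n"
  shows "card {b. middle C b} \<le> triangles n C"
proof -
  define TT where "TT = {T. T \<subseteq> {..<n} \<and> card T = 3 \<and> (\<forall>e. e \<subseteq> T \<and> card e = 2 \<longrightarrow> e \<in> C)}"
  have "\<exists>T\<in>TT. \<exists>a c. T = {a, b, c} \<and> a < b \<and> b < c" if mid: "middle C b" for b
  proof -
    obtain a c where abc: "a < b" "b < c" "{a, b} \<in> C" "{b, c} \<in> C" "{a, c} \<in> C"
      using mid by (auto simp: middle_def)
    have "e \<in> C" if e: "e \<subseteq> {a, b, c}" "card e = 2" for e
    proof -
      obtain x y where "e = {x, y}" "x \<noteq> y" using e(2) by (auto simp: card_2_iff)
      then show ?thesis using e(1) abc by (auto simp: insert_commute)
    qed
    moreover have "a < n" "b < n" "c < n" using abc assms pair_in_ecb_edges_iff by blast+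
    ultimately have "{a, b, c} \<in> TT" using abc by (auto simp: TT_def)
    then show ?thesis using abc by blast
  qed
  then obtain h where h: "\<And>b. middle C b \<Longrightarrow> h b \<in> TT \<and> (\<exists>a c. h b = {a, b, c} \<and> a < b \<and> b < c)"
    by metis
  have "inj_on h {b. middle C b}"
  proof (rule inj_onI)
    fix b b' assume b: "b \<in> {b. middle C b}" "b' \<in> {b. middle C b}" and eq: "h b = h b'"
    obtain a c where 1: "h b = {a, b, c}" "a < b" "b < c" using h b(1) by blast
    obtain a' c' where 2: "h b' = {a', b', c'}" "a' < b'" "b' < c'" using h b(2) by blast
    have eq': "{a, b, c} = {a', b', c'}" using eq 1(1) 2(1) by simp
    have "a \<in> {a', b', c'}" using eq' by blast
    then have "b \<noteq> a'" using 1(2) 2(2,3) by auto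
    moreover have "c \<in> {a', b', c'}" using eq' by blast
    then have "b \<noteq> c'" using 1(3) 2(2,3) by auto
    moreover have "b \<in> {a', b', c'}" using eq' by blast
    ultimately show "b = b'" by blast
  qed
  moreover have "h ` {b. middle C b} \<subseteq> TT" using h by auto
  moreover have "finite TT" by (rule finite_subset[of _ "Pow {..<n}"]) (auto simp: TT_def)
  ultimately show ?thesis unfolding triangles_def TT_def[symmetric] by (rule card_inj_on_le)
qed

section \<open>Chords between neighbours of a vertex\<close>

lemma uncrossed_antimono: "uncrossed C' a b \<Longrightarrow> C \<subseteq> C' \<Longrightarrow> uncrossed C a b"
  unfolding uncrossed_def by blast

text \<open>An edge crossing \<open>{x, y}\<close> crosses \<open>{a, x}\<close> or
  \<open>{a, y}\<close>, or it ends at \<open>a\<close>; in the last case its other end is a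
  neighbour of \<open>a\<close> strictly between \<open>x\<close> and \<open>y\<close>.\<close>

lemma uncrossed_consecutive_neighbours:
  assumes N: "noncrossing C" and "a < x" "x < y" "{a, x} \<in> C" "{a, y} \<in> C"
    and no: "\<And>w. x < w \<Longrightarrow> w < y \<Longrightarrow> {a, w} \<notin> C"
  shows "uncrossed C x y"
  unfolding uncrossed_def
proof (intro allI impI conjI notI)
  fix c d assume cd: "{c, d} \<in> C"
  show False if "x < c \<and> c < y \<and> y < d"
    using noncrossingD[OF N assms(5) cd] that assms(2) by linarith
  show False if h: "c < x \<and> x < d \<and> d < y"
  proof -
    consider "c < a" | "c = a" | "a < c" by linarith
    then show False
    proof cases
      case 1
      then show ?thesis using noncrossingD[OF N cd assms(5)] h assms(2) by linarith
    next
      case 2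
      then show ?thesis using no[of d] h cd by auto
    next
      case 3
      then show ?thesis using noncrossingD[OF N assms(4) cd] h by linarith
    qed
  qed
qed

text \<open>An edge crossing \<open>{p, q}\<close> crosses \<open>{p, a}\<close> or
  \<open>{a, q}\<close>, or it joins \<open>a\<close> to a vertex outside the range from
  \<open>p\<close> to \<open>q\<close>, against extremality.\<close>

lemma uncrossed_extreme_neighbours:
  assumes N: "noncrossing C" and "p < a" "a < q" "{p, a} \<in> C" "{a, q} \<in> C"
    and lo: "\<And>w. w < p \<Longrightarrow> {w, a} \<notin> C" and hi: "\<And>w. q < w \<Longrightarrow> {a, w} \<notin> C"
  shows "uncrossed C p q"
  unfolding uncrossed_def
proof (intro allI impI conjI notI)
  fix c d assume cd: "{c, d} \<in> C"
  show False if h: "p < c \<and> c < q \<and> q < d"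
  proof -
    consider "c < a" | "c = a" | "a < c" by linarith
    then show False
    proof cases
      case 1
      then show ?thesis using noncrossingD[OF N assms(4) cd] h assms(3) by linarith
    next
      case 2
      then show ?thesis using hi[of d] h cd by auto
    next
      case 3
      then show ?thesis using noncrossingD[OF N assms(5) cd] h by linarith
    qed
  qed
  show False if h: "c < p \<and> p < d \<and> d < q"
  proof -
    consider "d < a" | "d = a" | "a < d" by linarith
    then show False
    proof cases
      case 1
      then show ?thesis using noncrossingD[OF N cd assms(4)] h by linarith
    next
      case 2
      then show ?thesis using lo[of c] h cd by auto
    next
      case 3
      then show ?thesis using noncrossingD[OF N cd assms(5)] h assms(2) by linarith
    qed
  qed
qed

section \<open>Constructor's polygon, its gaps and the fresh vertices\<close>

definition adj :: "nat set \<Rightarrow> nat \<Rightarrow> nat \<Rightarrow> bool" where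
  "adj S l r \<longleftrightarrow> l \<in> S \<and> r \<in> S \<and> l < r \<and> (\<forall>x\<in>S. \<not> (l < x \<and> x < r))"

text \<open>A missing side is recorded by its lower end, which determines it. The base
  \<open>{0, m}\<close> does not count once \<open>S\<close> has a third vertex.\<close>

definition gaps :: "nat set \<Rightarrow> nat set set \<Rightarrow> nat set" where
  "gaps S C = {l. \<exists>r. adj S l r \<and> {l, r} \<notin> C}"

text \<open>Pairs inside \<open>F\<close> must be free too, so that the others stay fresh after one
  of them joins \<open>S\<close>.\<close>

definition fresh :: "nat \<Rightarrow> nat \<Rightarrow> nat set \<Rightarrow> nat set \<Rightarrow> nat set set \<Rightarrow> bool" where
  "fresh n m S F B \<longleftrightarrow> F \<subseteq> {m<..<n} \<and> (\<forall>z\<in>F. \<forall>x\<in>S \<union> F. {z, x} \<notin> B)"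

lemma adj_unique: "adj S l r \<Longrightarrow> adj S l r' \<Longrightarrow> r = r'"
  unfolding adj_def by (metis nat_neq_iff)

lemma adj_pair_neq: "adj S l r \<Longrightarrow> x < y \<Longrightarrow> \<not> adj S x y \<Longrightarrow> {l, r} \<noteq> {x, y}"
  by (auto simp: adj_def doubleton_eq_iff)

lemma finite_gaps: "finite S \<Longrightarrow> finite (gaps S C)"
  by (rule finite_subset[of _ S]) (auto simp: gaps_def adj_def)

lemma fresh_finite: "fresh n m S F B \<Longrightarrow> finite F"
  unfolding fresh_def by (meson finite_greaterThanLessThan finite_subset)

lemma fresh_block_inside:
  assumes "fresh n m S F B" "u \<in> S" "v \<in> S" "\<forall>x\<in>S. x \<le> m"
  shows "fresh n m S F (insert {u, v} B)"
proof -
  have "{z, x} \<noteq> {u, v}" if "z \<in> F" for z x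
  proof -
    have "z \<notin> S" using that assms(1,4) by (force simp: fresh_def)
    then show ?thesis using assms(2,3) by (auto simp: doubleton_eq_iff)
  qed
  then show ?thesis using assms(1) unfolding fresh_def by auto
qed

text \<open>A new Blocker edge conflicts only through both its ends together, so discarding one end
  from \<open>F\<close> repairs the condition.\<close>

lemma fresh_block:
  assumes "fresh n m S F B" "u \<noteq> v" "\<forall>x\<in>S. x \<le> m"
  obtains F' where "fresh n m S F' (insert {u, v} B)" "card F \<le> Suc (card F')"
proof -
  have FS: "z \<notin> S" if "z \<in> F" for z using that assms(1,3) by (force simp: fresh_def)
  define w where "w = (if u \<in> F then u else v)"
  have "fresh n m S (F - {w}) (insert {u, v} B)"
    using assms(1,2) FS unfolding fresh_def w_def by (auto simp: doubleton_eq_iff)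
  moreover have "card F \<le> Suc (card (F - {w}))"
    using fresh_finite[OF assms(1)]
    by (metis Diff_empty Diff_insert0 card_Suc_Diff1 le_SucI order_refl)
  ultimately show ?thesis by (rule that)
qed

text \<open>Constructor's edges live on the polygon \<open>S\<close> with extreme vertices \<open>0\<close> and \<open>m\<close>. Every side
  other than the base \<open>{0, m}\<close> is hers or is spanned by a common lower neighbour of its
  ends (a gap), and Blocker owns no diagonal that is still available for a triangulation of \<open>S\<close>.\<close>
locale polygon =
  fixes n m :: nat and S :: "nat set" and C B :: "nat set set"
  assumes finS: "finite S" and S_less: "x \<in> S \<Longrightarrow> x < n"
    and zero_in: "0 \<in> S" and m_in: "m \<in> S" and S_le: "x \<in> S \<Longrightarrow> x \<le> m" and m_pos: "0 < m"
    and C_inside: "e \<in> C \<Longrightarrow> \<exists>a\<in>S. \<exists>b\<in>S. a \<noteq> b \<and> e = {a, b}"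
    and nonc: "noncrossing C" and disj: "C \<inter> B = {}"
    and spanned: "adj S l r \<Longrightarrow> {l, r} \<in> C \<or> (\<exists>p<l. {p, l} \<in> C \<and> {p, r} \<in> C)"
    and clean: "a \<in> S \<Longrightarrow> b \<in> S \<Longrightarrow> a < b \<Longrightarrow> {a, b} \<in> B \<Longrightarrow> uncrossed C a b \<Longrightarrow>
      adj S a b \<or> a = 0 \<and> b = m"
begin

lemma edgeD: "{a, b} \<in> C \<Longrightarrow> a \<in> S \<and> b \<in> S \<and> a \<noteq> b"
  using C_inside[of "{a, b}"] by (auto simp: doubleton_eq_iff)

lemma C_edges: "C \<subseteq> ecb_edges n"
  using C_inside S_less by (force simp: pair_in_ecb_edges_iff)

lemma finite_nbrs: "finite {w. {a, w} \<in> C \<and> P w}" "finite {w. {w, a} \<in> C \<and> P w}"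
  by (rule finite_subset[OF _ finS]; use edgeD in blast)+

lemma pred_ex:
  assumes "b \<in> S" "0 < b" obtains l where "adj S l b"
proof -
  have fin: "finite {x\<in>S. x < b}" using finS by simp
  have "{x\<in>S. x < b} \<noteq> {}" using assms zero_in by blast
  then have "Max {x\<in>S. x < b} \<in> {x\<in>S. x < b}" using fin by (rule Max_in[rotated])
  moreover have "\<not> (Max {x\<in>S. x < b} < x \<and> x < b)" if "x \<in> S" for x
    using Max_ge[OF fin, of x] that by (metis (no_types, lifting) mem_Collect_eq not_less)
  ultimately have "adj S (Max {x\<in>S. x < b}) b" using assms(1) unfolding adj_def by blast
  then show ?thesis by (rule that)
qed

lemma succ_ex:
  assumes "b \<in> S" "b < m" obtains r where "adj S b r"
proof -
  have fin: "finite {x\<in>S. b < x}" using finS by simp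
  have "{x\<in>S. b < x} \<noteq> {}" using assms m_in by blast
  then have "Min {x\<in>S. b < x} \<in> {x\<in>S. b < x}" using fin by (rule Min_in[rotated])
  moreover have "\<not> (b < x \<and> x < Min {x\<in>S. b < x})" if "x \<in> S" for x
    using Min_le[OF fin, of x] that by (metis (no_types, lifting) mem_Collect_eq not_less)
  ultimately have "adj S b (Min {x\<in>S. b < x})" using assms(1) unfolding adj_def by blast
  then show ?thesis by (rule that)
qed

text \<open>The side ending at \<open>b\<close> supplies a lower neighbour, or, if that side is a
  gap, the common lower neighbour of its ends does.\<close>

lemma min_nbr:
  assumes "b \<in> S" "0 < b"
  obtains p where "p < b" "{p, b} \<in> C" "\<And>w. w < p \<Longrightarrow> {w, b} \<notin> C"
proof -
  obtain l where l: "adj S l b" using pred_ex assms by blast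
  then have "l < b" by (simp add: adj_def)
  with spanned[OF l] have ex: "\<exists>p. p < b \<and> {p, b} \<in> C" by (metis order.strict_trans)
  define p where "p = (LEAST p. p < b \<and> {p, b} \<in> C)"
  have p: "p < b" "{p, b} \<in> C" using LeastI_ex[OF ex] by (auto simp: p_def)
  moreover have "{w, b} \<notin> C" if "w < p" for w
    using not_less_Least[of w "\<lambda>p. p < b \<and> {p, b} \<in> C"] that p(1) by (auto simp: p_def[symmetric])
  ultimately show ?thesis by (rule that)
qed

lemma max_nbr:
  assumes "{b, w} \<in> C" "b < w"
  obtains q where "b < q" "{b, q} \<in> C" "\<And>w. q < w \<Longrightarrow> {b, w} \<notin> C"
proof -
  define Q where "Q = {w. {b, w} \<in> C \<and> b < w}"
  have fin: "finite Q" unfolding Q_def by (rule finite_nbrs)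
  have "Q \<noteq> {}" using assms by (auto simp: Q_def)
  then have "Max Q \<in> Q" using fin by (rule Max_in[rotated])
  then have q: "b < Max Q" "{b, Max Q} \<in> C" unfolding Q_def by simp_all
  have "{b, w} \<notin> C" if "Max Q < w" for w
  proof
    assume "{b, w} \<in> C"
    then have "w \<in> Q" using that q(1) unfolding Q_def by simp
    then show False using Max_ge[OF fin] that by (meson not_less)
  qed
  with q show ?thesis by (rule that)
qed

lemma insert_edge:
  assumes "x \<in> S" "y \<in> S" "x < y" "uncrossed C x y" "{x, y} \<notin> B"
  shows "polygon n m S (insert {x, y} C) B"
proof
  show "noncrossing (insert {x, y} C)" using noncrossing_insert[OF nonc] assms by blast
  show "\<exists>a\<in>S. \<exists>b\<in>S. a \<noteq> b \<and> e = {a, b}" if "e \<in> insert {x, y} C" for e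
    using that C_inside assms by (metis insertE nat_neq_iff)
  show "adj S a b \<or> a = 0 \<and> b = m"
    if "a \<in> S" "b \<in> S" "a < b" "{a, b} \<in> B" "uncrossed (insert {x, y} C) a b" for a b
    using clean that uncrossed_antimono by blast
qed (use finS S_less zero_in m_in S_le m_pos disj assms spanned in blast)+

lemma block:
  assumes "f \<notin> C"
    and "\<And>a b. f = {a, b} \<Longrightarrow> a \<in> S \<Longrightarrow> b \<in> S \<Longrightarrow> a < b \<Longrightarrow> uncrossed C a b \<Longrightarrow>
      adj S a b \<or> a = 0 \<and> b = m"
  shows "polygon n m S C (insert f B)"
proof
  show "adj S a b \<or> a = 0 \<and> b = m"
    if "a \<in> S" "b \<in> S" "a < b" "{a, b} \<in> insert f B" "uncrossed C a b" for a b
    using clean[of a b] assms(2)[of a b] that by blast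
qed (use finS S_less zero_in m_in S_le m_pos disj assms(1) spanned nonc C_inside in blast)+

text \<open>The crossing edge joins two neighbours of an endpoint of \<open>{a, b}\<close> that are consecutive to
  \<open>b\<close>, respectively \<open>a\<close>, in the rotation at that endpoint.\<close>
lemma crossing_reply:
  assumes ab: "a \<in> S" "b \<in> S" "a < b" "uncrossed C a b" "{a, b} \<notin> C"
    and diag: "\<not> adj S a b" "\<not> (a = 0 \<and> b = m)"
  obtains x y where "x \<in> S" "y \<in> S" "x < y" "uncrossed C x y"
    "a < x \<and> x < b \<and> b < y \<or> x < a \<and> a < y \<and> y < b"
proof (cases "a = 0")
  case False
  have "a < m" using ab S_le by fastforce
  then obtain r where r: "adj S a r" using succ_ex ab by blast
  have "r < b"
  proof -
    have "r \<noteq> b" using r diag by blast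
    moreover have "\<not> b < r" using r ab unfolding adj_def by blast
    ultimately show ?thesis by simp
  qed
  have "a < r" using r by (simp add: adj_def)
  \<comment> \<open>If this side were a gap, the edge from its common neighbour below
    \<open>a\<close> to \<open>r\<close> would cross \<open>{a, b}\<close>.\<close>
  have "{a, r} \<in> C"
  proof (rule ccontr)
    assume "{a, r} \<notin> C"
    then obtain p where "p < a" "{p, r} \<in> C" using spanned[OF r] by blast
    then show False using ab(4) \<open>a < r\<close> \<open>r < b\<close> unfolding uncrossed_def by blast
  qed
  define X where "X = {x. {a, x} \<in> C \<and> a < x \<and> x < b}"
  have finX: "finite X" unfolding X_def by (rule finite_nbrs)
  define x where "x = Max X"
  have "X \<noteq> {}" using \<open>{a, r} \<in> C\<close> \<open>a < r\<close> \<open>r < b\<close> by (auto simp: X_def)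
  then have x: "{a, x} \<in> C" "a < x" "x < b" using Max_in[OF finX] by (auto simp: x_def X_def)
  have xmax: "w \<le> x" if "{a, w} \<in> C" "w < b" "a < w" for w
    unfolding x_def using that by (intro Max_ge[OF finX]) (auto simp: X_def)
  show ?thesis
  proof (cases "\<exists>y. b < y \<and> {a, y} \<in> C")
    case True
    define y where "y = (LEAST y. b < y \<and> {a, y} \<in> C)"
    have y: "b < y" "{a, y} \<in> C" using LeastI_ex[OF True] by (auto simp: y_def)
    have "{a, w} \<notin> C" if "x < w" "w < y" for w
    proof
      assume w: "{a, w} \<in> C"
      have "\<not> b < w" using not_less_Least[of w "\<lambda>y. b < y \<and> {a, y} \<in> C"] that w
        by (auto simp: y_def[symmetric])
      moreover have "w \<noteq> b" using w ab by blast
      ultimately show False using xmax[OF w] that x by linarith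
    qed
    then have "uncrossed C x y"
      using x y by (intro uncrossed_consecutive_neighbours[OF nonc, of a]) auto
    then show ?thesis using x y edgeD by (intro that[of x y]) auto
  next
    case none: False
    \<comment> \<open>With no neighbour of \<open>a\<close> beyond \<open>b\<close>, the rotation
      wraps around to the lowest neighbour.\<close>
    obtain p where p: "p < a" "{p, a} \<in> C" "\<And>w. w < p \<Longrightarrow> {w, a} \<notin> C"
      using min_nbr ab(1) False by blast
    have "{a, w} \<notin> C" if "x < w" for w
    proof
      assume w: "{a, w} \<in> C"
      then have "\<not> b < w" "w \<noteq> b" using none ab by blast+
      then show False using xmax[OF w] that x by linarith
    qed
    then have "uncrossed C p x"
      using x p by (intro uncrossed_extreme_neighbours[OF nonc, of p a]) auto
    then show ?thesis using x p edgeD by (intro that[of p x]) auto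
  qed
next
  case True
  \<comment> \<open>Vertex 0 has no lower neighbour to wrap around to, so the rotation at
    \<open>b\<close> is used instead.\<close>
  then have "b < m" using ab diag S_le by (metis le_neq_implies_less)
  obtain p where p: "p < b" "{p, b} \<in> C" "\<And>w. w < p \<Longrightarrow> {w, b} \<notin> C"
    using min_nbr ab by (metis gr_zeroI not_less_zero)
  have "p \<noteq> 0" using p(2) ab(5) True by metis
  obtain r where r: "adj S b r" using succ_ex \<open>b < m\<close> ab by blast
  then have "b < r" by (simp add: adj_def)
  have "{b, r} \<in> C"
  proof (rule ccontr)
    assume "{b, r} \<notin> C"
    then obtain p where p: "p < b" "{p, b} \<in> C" "{p, r} \<in> C" using spanned[OF r] by blast
    then have "p \<noteq> a" using ab by auto
    then show False using p ab(4) True \<open>b < r\<close> unfolding uncrossed_def by blast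
  qed
  then obtain q where q: "b < q" "{b, q} \<in> C" "\<And>w. q < w \<Longrightarrow> {b, w} \<notin> C"
    using max_nbr \<open>b < r\<close> by blast
  have "uncrossed C p q" using p q by (intro uncrossed_extreme_neighbours[OF nonc, of p b]) auto
  then show ?thesis using p q edgeD True \<open>p \<noteq> 0\<close> by (intro that[of p q]) auto
qed

lemma adj_insert_top:
  assumes "m < z" shows "adj (insert z S) l r \<longleftrightarrow> adj S l r \<or> l = m \<and> r = z"
proof
  assume L: "adj (insert z S) l r"
  have "l \<noteq> z" using L S_le assms unfolding adj_def by fastforce
  then have "l \<in> S" using L by (auto simp: adj_def)
  show "adj S l r \<or> l = m \<and> r = z"
  proof (cases "r = z")
    case True
    then have "\<not> l < m" using L m_in assms unfolding adj_def by blast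
    then show ?thesis using S_le[OF \<open>l \<in> S\<close>] True by auto
  qed (use L \<open>l \<in> S\<close> in \<open>auto simp: adj_def\<close>)
next
  assume "adj S l r \<or> l = m \<and> r = z"
  then show "adj (insert z S) l r" using S_le m_in assms unfolding adj_def by force
qed

text \<open>For \<open>q = m\<close> the new side is Constructor's; otherwise \<open>{m, z}\<close>
  becomes a gap spanned by \<open>q\<close>. The old base turns into a diagonal, which is why it
  must be free of Blocker or crossed.\<close>

lemma extend:
  assumes z: "m < z" "z < n" "\<And>x. x \<in> S \<Longrightarrow> {z, x} \<notin> B"
    and q: "q \<in> S" "uncrossed C q z" "q = m \<or> {q, m} \<in> C"
    and base: "uncrossed (insert {q, z} C) 0 m \<Longrightarrow> {0, m} \<notin> B"
  shows "polygon n z (insert z S) (insert {q, z} C) B"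
proof
  have "q \<le> m" using q S_le by blast
  show "noncrossing (insert {q, z} C)"
    using noncrossing_insert[OF nonc _ q(2)] \<open>q \<le> m\<close> z by linarith
  show "\<exists>a\<in>insert z S. \<exists>b\<in>insert z S. a \<noteq> b \<and> e = {a, b}" if "e \<in> insert {q, z} C" for e
  proof (cases "e = {q, z}")
    case True
    then show ?thesis using q(1) \<open>q \<le> m\<close> z(1) by (intro bexI[of _ q] bexI[of _ z]) auto
  qed (use that C_inside in blast)
  show "insert {q, z} C \<inter> B = {}" using disj z(3)[OF q(1)] by (auto simp: insert_commute)
  show "{l, r} \<in> insert {q, z} C \<or> (\<exists>p<l. {p, l} \<in> insert {q, z} C \<and> {p, r} \<in> insert {q, z} C)"
    if "adj (insert z S) l r" for l r
    using that unfolding adj_insert_top[OF z(1)]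
  proof
    assume "adj S l r" then show ?thesis using spanned by blast
  next
    assume "l = m \<and> r = z"
    moreover have "q < m \<and> {q, m} \<in> C" if "q \<noteq> m" using that q(3) \<open>q \<le> m\<close> by auto
    ultimately show ?thesis by (cases "q = m") blast+
  qed
  show "adj (insert z S) a b \<or> a = 0 \<and> b = z"
    if ab: "a \<in> insert z S" "b \<in> insert z S" "a < b" "{a, b} \<in> B" "uncrossed (insert {q, z} C) a b" for a b
  proof -
    have "a \<noteq> z" using ab S_le z(1) by fastforce
    moreover have "b \<noteq> z" using ab z(3)[of a] by (auto simp: insert_commute)
    ultimately have "adj S a b \<or> a = 0 \<and> b = m"
      using clean[of a b] ab uncrossed_antimono[OF ab(5)] by blast
    then show ?thesis using base ab adj_insert_top[OF z(1)] by auto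
  qed
  show "x \<le> z" if "x \<in> insert z S" for x using that S_le z(1) by fastforce
qed (use finS S_less zero_in z m_pos in auto)

lemma m_notin_gaps: "m \<notin> gaps S C"
  using S_le by (force simp: gaps_def adj_def)

lemma z_notin_C: "m < z \<Longrightarrow> {x, z} \<notin> C"
  using edgeD S_le by fastforce

lemma gaps_extend_side:
  assumes "m < z" shows "gaps (insert z S) (insert {m, z} C) = gaps S C"
proof -
  have "{l, r} \<noteq> {m, z}" if "adj S l r" for l r
    using that S_le assms unfolding adj_def doubleton_eq_iff by fastforce
  then show ?thesis using adj_insert_top[OF assms] unfolding gaps_def by auto
qed

lemma gaps_extend_fan:
  assumes "m < z" "q < m" shows "gaps (insert z S) (insert {q, z} C) = insert m (gaps S C)"
proof -
  have "{l, r} \<noteq> {q, z}" if "adj S l r" for l r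
    using that S_le assms unfolding adj_def doubleton_eq_iff by fastforce
  moreover have "{m, z} \<notin> insert {q, z} C"
    using z_notin_C[OF assms(1)] assms by (auto simp: doubleton_eq_iff)
  ultimately show ?thesis using adj_insert_top[OF assms(1)] unfolding gaps_def by auto
qed

lemma gaps_fill:
  assumes "adj S l m" shows "gaps S (insert {l, m} C) = gaps S C - {l}"
proof -
  have "{l', r} = {l, m} \<longleftrightarrow> l' = l" if "adj S l' r" for l' r
    using adj_unique[OF assms] that assms unfolding adj_def doubleton_eq_iff by (metis order.asym)
  then show ?thesis unfolding gaps_def by auto
qed

text \<open>For a vertex \<open>b\<close> other than \<open>0\<close>, \<open>m\<close> and the
  lower ends of gaps, the chord between its extreme neighbours is uncrossed. If it is Constructor's,
  \<open>b\<close> is a middle vertex; if Blocker's, it is the base. The 3 accounts for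
  \<open>0\<close>, \<open>m\<close> and one apex over the base.\<close>

lemma card_le_triangles:
  assumes full: "\<And>x y. x \<in> S \<Longrightarrow> y \<in> S \<Longrightarrow> x < y \<Longrightarrow> uncrossed C x y \<Longrightarrow> {x, y} \<in> C \<union> B"
  shows "card S \<le> triangles n C + card (gaps S C) + 3"
proof -
  define X where "X = {b. 0 < b \<and> b < m \<and> {0, b} \<in> C \<and> {b, m} \<in> C}"
  \<comment> \<open>Two apexes \<open>b < b'\<close> over the base would make \<open>{0, b'}\<close>
    cross \<open>{b, m}\<close>.\<close>
  have X1: "b = b'" if "b \<in> X" "b' \<in> X" for b b'
    using that noncrossingD[OF nonc, of 0 b' b m] noncrossingD[OF nonc, of 0 b b' m]
    unfolding X_def by fastforce
  have "finite X" unfolding X_def by (rule finite_subset[of _ "{..<m}"]) auto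
  have "card X \<le> 1" using X1 \<open>finite X\<close> by (metis One_nat_def card_le_Suc0_iff_eq)
  have "S \<subseteq> {b. middle C b} \<union> (gaps S C \<union> (X \<union> {0, m}))"
  proof
    fix b assume b: "b \<in> S"
    show "b \<in> {b. middle C b} \<union> (gaps S C \<union> (X \<union> {0, m}))"
    proof (rule ccontr)
      assume neg: "\<not> ?thesis"
      then have "0 < b" "b < m" using S_le[OF b] by auto
      obtain p where p: "p < b" "{p, b} \<in> C" "\<And>w. w < p \<Longrightarrow> {w, b} \<notin> C"
        using min_nbr b \<open>0 < b\<close> by blast
      obtain r where r: "adj S b r" using succ_ex b \<open>b < m\<close> by blast
      have "{b, r} \<in> C" "b < r" using neg r by (auto simp: gaps_def adj_def)
      then obtain q where q: "b < q" "{b, q} \<in> C" "\<And>w. q < w \<Longrightarrow> {b, w} \<notin> C"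
        using max_nbr by blast
      have u: "uncrossed C p q" using p q by (intro uncrossed_extreme_neighbours[OF nonc, of p b]) auto
      have pq: "p \<in> S" "q \<in> S" using p q edgeD by blast+
      have "{p, q} \<notin> C" using neg p q by (auto simp: middle_def)
      then have "{p, q} \<in> B" using full[OF pq _ u] p q by auto
      then have "adj S p q \<or> p = 0 \<and> q = m" using clean[OF pq _ _ u] p q by auto
      then have "p = 0" "q = m" using b p q by (auto simp: adj_def)
      then show False using neg p q \<open>0 < b\<close> by (auto simp: X_def)
    qed
  qed
  moreover have finM: "finite {b. middle C b}"
    by (rule finite_subset[of _ "{..<n}"]) (use middle_less[OF C_edges] in auto)
  ultimately have "card S \<le> card ({b. middle C b} \<union> (gaps S C \<union> (X \<union> {0, m})))"
    using finite_gaps[OF finS] \<open>finite X\<close> by (intro card_mono) auto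
  also have "\<dots> \<le> card {b. middle C b} + (card (gaps S C) + (card X + card {0, m}))"
    by (meson add_left_mono card_Un_le order_trans)
  also have "\<dots> \<le> triangles n C + card (gaps S C) + 3"
    using card_middle_le_triangles[OF C_edges] \<open>card X \<le> 1\<close> m_pos by simp
  finally show ?thesis .
qed

end

section \<open>The surplus invariant and Constructor's replies\<close>

text \<open>The four disjuncts, for a position with Blocker to move: base not blocked; surplus one
  larger; base not blocked and a gap at the top that Constructor threatens to fill; no fresh
  vertices left.\<close>
definition margin :: "nat \<Rightarrow> nat \<Rightarrow> nat set \<Rightarrow> nat set \<Rightarrow> nat set set \<Rightarrow> nat set set \<Rightarrow> bool" where
  "margin n m S F C B \<longleftrightarrow>
     ({0, m} \<notin> B \<and> n + 2 + 2 * card (gaps S C) \<le> card F + 2 * card S \<or>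
      n + 3 + 2 * card (gaps S C) \<le> card F + 2 * card S \<or>
      {0, m} \<notin> B \<and> n + 1 + 2 * card (gaps S C) \<le> card F + 2 * card S \<and>
        (\<exists>l. adj S l m \<and> {l, m} \<notin> C \<and> {l, m} \<notin> B) \<or>
      F = {} \<and> n + 1 + 2 * card (gaps S C) \<le> card F + 2 * card S)"

text \<open>Call \<open>card F + 2 * card S - 2 * card (gaps S C) - n\<close> the surplus. Blocker's
  move lowers it by at most one; joining a new vertex to \<open>m\<close> raises it by one, a fan
  edge lowers it by one, filling a gap raises it by two.\<close>

definition good :: "nat \<Rightarrow> nat set set \<Rightarrow> nat set set \<Rightarrow> bool" where
  "good n C B \<longleftrightarrow> (\<exists>m S F. polygon n m S C B \<and> fresh n m S F B \<and> margin n m S F C B)"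

text \<open>The constant 5 arises when Constructor is stuck with no fresh vertices counted: surplus
  at least 1 and \<open>card_le_triangles\<close> give
  \<open>n + 1 \<le> 2 * triangles n C + 6\<close>.\<close>

definition good_reply :: "nat \<Rightarrow> nat set set \<Rightarrow> nat set set \<Rightarrow> bool" where
  "good_reply n C B \<longleftrightarrow> (\<exists>e\<in>legalC n C B. good n (insert e C) B) \<or> n \<le> 2 * triangles n C + 5"

context polygon
begin

lemma legal_inside:
  assumes "x \<in> S" "y \<in> S" "x < y" "uncrossed C x y" "{x, y} \<notin> C" "{x, y} \<notin> B"
  shows "{x, y} \<in> legalC n C B"
  using assms S_less by (intro legalC_uncrossedI[OF C_edges]) auto

text \<open>Edges inside \<open>S\<close> can only close gaps, so the surplus survives any of them;
  once none is available, \<open>card_le_triangles\<close> applies.\<close>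

lemma reply_without_fresh:
  assumes "n + 1 + 2 * card (gaps S C) \<le> 2 * card S"
  shows "good_reply n C B"
proof (cases "\<exists>x y. x \<in> S \<and> y \<in> S \<and> x < y \<and> uncrossed C x y \<and> {x, y} \<notin> C \<and> {x, y} \<notin> B")
  case True
  then obtain x y where xy: "x \<in> S" "y \<in> S" "x < y" "uncrossed C x y" "{x, y} \<notin> C" "{x, y} \<notin> B"
    by blast
  have "card (gaps S (insert {x, y} C)) \<le> card (gaps S C)"
    by (rule card_mono[OF finite_gaps[OF finS]]) (auto simp: gaps_def)
  then have "good n (insert {x, y} C) B"
    unfolding good_def margin_def using insert_edge[OF xy(1-4,6)] assms
    by (intro exI[of _ m] exI[of _ S] exI[of _ "{}"]) (auto simp: fresh_def)
  then show ?thesis using legal_inside[OF xy] unfolding good_reply_def by blast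
next
  case False
  then have "card S \<le> triangles n C + card (gaps S C) + 3" by (intro card_le_triangles) blast
  then show ?thesis using assms unfolding good_reply_def by linarith
qed

lemma fresh_extend:
  assumes "fresh n m S F B" "F \<noteq> {}"
  obtains z where "m < z" "z < n" "z \<in> F" "\<And>x. x \<in> S \<Longrightarrow> {z, x} \<notin> B"
    "fresh n z (insert z S) (F - {z}) B" "card F = Suc (card (F - {z}))"
    "card (insert z S) = Suc (card S)"
proof -
  have fin: "finite F" using fresh_finite assms by blast
  \<comment> \<open>Taking the smallest fresh vertex keeps all others above the new top.\<close>
  define z where "z = Min F"
  have z: "z \<in> F" using Min_in[OF fin assms(2)] by (simp add: z_def)
  then have z': "m < z" "z < n" using assms(1) by (auto simp: fresh_def)
  have "z \<le> w" if "w \<in> F" for w using Min_le[OF fin that] by (simp add: z_def)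
  then have "F - {z} \<subseteq> {z<..<n}" using assms(1) unfolding fresh_def by force
  then have "fresh n z (insert z S) (F - {z}) B"
    using assms(1) z unfolding fresh_def by blast
  moreover have "card F = Suc (card (F - {z}))" using z fin by (metis card.remove)
  moreover have "z \<notin> S" using z' S_le by fastforce
  then have "card (insert z S) = Suc (card S)" using finS by simp
  moreover have "\<And>x. x \<in> S \<Longrightarrow> {z, x} \<notin> B" using assms(1) z by (auto simp: fresh_def)
  ultimately show ?thesis using that z z' by blast
qed

text \<open>The surplus rises from 1 to 2, and the new base \<open>{0, z}\<close> is free because
  \<open>z\<close> was fresh.\<close>

lemma reply_side:
  assumes F: "fresh n m S F B" and base: "{0, m} \<notin> B"
    and count: "n + 1 + 2 * card (gaps S C) \<le> card F + 2 * card S"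
  shows "good_reply n C B"
proof (cases "F = {}")
  case True
  then show ?thesis using reply_without_fresh count by simp
next
  case False
  then obtain z where z: "m < z" "z < n" "z \<in> F" "\<And>x. x \<in> S \<Longrightarrow> {z, x} \<notin> B"
    "fresh n z (insert z S) (F - {z}) B" "card F = Suc (card (F - {z}))"
    "card (insert z S) = Suc (card S)"
    using fresh_extend[OF F] by blast
  have u: "uncrossed C m z" unfolding uncrossed_def using edgeD S_le by fastforce
  have "{m, z} \<in> legalC n C B"
    by (rule legalC_uncrossedI[OF C_edges])
      (use z u z_notin_C[OF z(1)] z(4)[OF m_in] in \<open>auto simp: insert_commute\<close>)
  moreover have "polygon n z (insert z S) (insert {m, z} C) B"
    using extend[OF z(1,2,4) m_in u] base by blast
  moreover have "{0, z} \<notin> B" using z(4)[OF zero_in] by (simp add: insert_commute)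
  moreover have "n + 2 + 2 * card (gaps (insert z S) (insert {m, z} C))
      \<le> card (F - {z}) + 2 * card (insert z S)"
    unfolding gaps_extend_side[OF z(1)] using count z(6,7) by linarith
  ultimately show ?thesis unfolding good_reply_def good_def margin_def using z(5) by blast
qed

text \<open>Blocker owns \<open>{0, m}\<close>, so \<open>p > 0\<close> and \<open>{p, z}\<close>
  crosses it. The surplus drops from 2 to 1, compensated by the threat to fill the new gap
  \<open>{m, z}\<close>.\<close>

lemma reply_fan:
  assumes F: "fresh n m S F B" and base: "{0, m} \<in> B"
    and count: "n + 2 + 2 * card (gaps S C) \<le> card F + 2 * card S"
  shows "good_reply n C B"
proof (cases "F = {}")
  case True
  then show ?thesis using reply_without_fresh count by simp
next
  case False
  then obtain z where z: "m < z" "z < n" "z \<in> F" "\<And>x. x \<in> S \<Longrightarrow> {z, x} \<notin> B"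
    "fresh n z (insert z S) (F - {z}) B" "card F = Suc (card (F - {z}))"
    "card (insert z S) = Suc (card S)"
    using fresh_extend[OF F] by blast
  obtain p where p: "p < m" "{p, m} \<in> C" "\<And>w. w < p \<Longrightarrow> {w, m} \<notin> C"
    using min_nbr[OF m_in m_pos] by blast
  have "p \<in> S" using p edgeD by blast
  have "p \<noteq> 0" using p(2) base disj by (metis disjoint_iff)
  have u: "uncrossed C p z"
    unfolding uncrossed_def
  proof (intro allI impI conjI notI)
    fix c d assume cd: "{c, d} \<in> C"
    then have le: "c \<le> m" "d \<le> m" using edgeD S_le by blast+
    show False if "p < c \<and> c < z \<and> z < d" using that le z(1) by linarith
    \<comment> \<open>An edge from below \<open>p\<close> to above it would end at \<open>m\<close>,
      against the choice of \<open>p\<close>, or cross \<open>{p, m}\<close>.\<close>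
    show False if h: "c < p \<and> p < d \<and> d < z"
    proof (cases "d = m")
      case True
      then show False using p(3)[of c] h cd by blast
    next
      case False
      then show False using noncrossingD[OF nonc cd p(2)] h le by linarith
    qed
  qed
  have crossed: "\<not> uncrossed (insert {p, z} C) 0 m"
    unfolding uncrossed_def using \<open>p \<noteq> 0\<close> p(1) z(1) by blast
  have "{p, z} \<in> legalC n C B"
    by (rule legalC_uncrossedI[OF C_edges])
      (use z u p z_notin_C[OF z(1)] z(4)[OF \<open>p \<in> S\<close>] in \<open>auto simp: insert_commute\<close>)
  moreover have "polygon n z (insert z S) (insert {p, z} C) B"
    using extend[OF z(1,2,4) \<open>p \<in> S\<close> u] p crossed by blast
  moreover have "{0, z} \<notin> B" using z(4)[OF zero_in] by (simp add: insert_commute)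
  moreover have "card (insert m (gaps S C)) = Suc (card (gaps S C))"
    using m_notin_gaps finite_gaps[OF finS] by simp
  then have "n + 1 + 2 * card (gaps (insert z S) (insert {p, z} C))
      \<le> card (F - {z}) + 2 * card (insert z S)"
    unfolding gaps_extend_fan[OF z(1) p(1)] using count z(6,7) by linarith
  moreover have "adj (insert z S) m z" using adj_insert_top[OF z(1)] by blast
  moreover have "{m, z} \<notin> insert {p, z} C"
    using z_notin_C[OF z(1)] p(1) z(1) by (auto simp: doubleton_eq_iff)
  moreover have "{m, z} \<notin> B" using z(4)[OF m_in] by (simp add: insert_commute)
  ultimately show ?thesis unfolding good_reply_def good_def margin_def using z(5) by blast
qed

text \<open>The gain of two reaches surplus 2 with a free base, or surplus 3 with a blocked
  one.\<close>

lemma reply_fill_gap: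
  assumes F: "fresh n m S F B" and l: "adj S l m" "{l, m} \<notin> C" "{l, m} \<notin> B"
    and count: "n + 2 * card (gaps S C) \<le> card F + 2 * card S"
    and base: "{0, m} \<in> B \<Longrightarrow> n + 1 + 2 * card (gaps S C) \<le> card F + 2 * card S"
  shows "good_reply n C B"
proof -
  have lS: "l \<in> S" "l < m" using l by (auto simp: adj_def)
  have u: "uncrossed C l m"
    using l(1) S_le edgeD unfolding uncrossed_def adj_def by fastforce
  have "l \<in> gaps S C" using l by (auto simp: gaps_def)
  then have "card (gaps S C) = Suc (card (gaps S (insert {l, m} C)))"
    unfolding gaps_fill[OF l(1)] using finite_gaps[OF finS] by (metis card.remove)
  then have "{0, m} \<notin> B \<and> n + 2 + 2 * card (gaps S (insert {l, m} C)) \<le> card F + 2 * card S \<or>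
      n + 3 + 2 * card (gaps S (insert {l, m} C)) \<le> card F + 2 * card S"
    using count base by (cases "{0, m} \<in> B") auto
  then have "good n (insert {l, m} C) B"
    unfolding good_def margin_def using insert_edge[OF lS(1) m_in lS(2) u l(3)] F by blast
  then show ?thesis using legal_inside[OF lS(1) m_in lS(2) u l(2,3)] unfolding good_reply_def by blast
qed

end

text \<open>For the end of the game: when no legal edge is left, the only surviving alternative is
  the triangle bound.\<close>

lemma good_imp_good_reply:
  assumes "good n C B" shows "good_reply n C B"
proof -
  obtain m S F where "polygon n m S C B" and F: "fresh n m S F B"
    and cases: "margin n m S F C B"
    using assms unfolding good_def by blast
  then interpret polygon n m S C B by blast
  note cases = cases[unfolded margin_def]
  show ?thesis
  proof (cases "{0, m} \<in> B")
    case True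
    then have "n + 2 + 2 * card (gaps S C) \<le> card F + 2 * card S \<or>
        n + 1 + 2 * card (gaps S C) \<le> 2 * card S" using cases by force
    then show ?thesis using reply_fan[OF F True] reply_without_fresh by blast
  next
    case False
    show ?thesis by (rule reply_side[OF F False]) (use cases in linarith)
  qed
qed

lemma good_reply_Blocker_move:
  assumes "good n C B" and f: "f \<in> ecb_edges n - C - B"
  shows "good_reply n C (insert f B)"
proof -
  obtain m S F where "polygon n m S C B" and F: "fresh n m S F B"
    and cases: "margin n m S F C B"
    using assms(1) unfolding good_def by blast
  then interpret P: polygon n m S C B by blast
  have le: "\<forall>x\<in>S. x \<le> m" using P.S_le by blast
  obtain u v where uv: "f = {u, v}" "u < v" "v < n" using f ecb_edgesE by blast
  have fC: "f \<notin> C" using f by blast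
  have inside: "fresh n m S F (insert f B)" if "u \<in> S" "v \<in> S"
    unfolding uv(1) by (rule fresh_block_inside[OF F that le])
  show ?thesis
  proof (cases "u \<in> S \<and> v \<in> S \<and> uncrossed C u v \<and> \<not> adj S u v \<and> \<not> (u = 0 \<and> v = m)")
    \<comment> \<open>Crossing the blocked diagonal costs nothing: \<open>f\<close> spoils no fresh
      vertex and \<open>{x, y}\<close> is not a side, so the margin is unchanged.\<close>
    case True
    then obtain x y where xy: "x \<in> S" "y \<in> S" "x < y" "uncrossed C x y"
      and cr: "u < x \<and> x < v \<and> v < y \<or> x < u \<and> u < y \<and> y < v"
      using P.crossing_reply[of u v] uv fC by blast
    have nadj: "\<not> adj S x y" using cr True unfolding adj_def by blast
    have base': "\<not> (x = 0 \<and> y = m)" using cr P.S_le[of v] True by auto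
    have fxy: "{x, y} \<noteq> f" using cr uv by (auto simp: doubleton_eq_iff)
    have xyB: "{x, y} \<notin> insert f B" using P.clean xy nadj base' fxy by blast
    have xyC: "{x, y} \<notin> C" using True cr unfolding uncrossed_def by blast
    have "polygon n m S (insert {x, y} C) B" using P.insert_edge xy xyB by blast
    then interpret Q: polygon n m S "insert {x, y} C" B .
    have "\<not> uncrossed (insert {x, y} C) u v" unfolding uncrossed_def using cr by blast
    then have poly: "polygon n m S (insert {x, y} C) (insert f B)"
      using fC fxy uv by (intro Q.block) (auto simp: doubleton_eq_iff)
    have legal: "{x, y} \<in> legalC n C (insert f B)"
      using xy xyB xyC P.S_less by (intro legalC_uncrossedI[OF P.C_edges]) auto
    have gaps: "gaps S (insert {x, y} C) = gaps S C"
      using adj_pair_neq[OF _ xy(3) nadj] unfolding gaps_def by blast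
    have "{0, m} \<noteq> f" using True uv by (auto simp: doubleton_eq_iff)
    moreover have "{l, m} \<noteq> f \<and> {l, m} \<noteq> {x, y}" if "adj S l m" for l
      using adj_pair_neq[OF that xy(3) nadj] adj_pair_neq[OF that uv(2)] True uv(1) by blast
    ultimately have "margin n m S F (insert {x, y} C) (insert f B)"
      using cases unfolding margin_def gaps insert_iff by blast
    then show ?thesis unfolding good_reply_def good_def using poly legal inside True by blast
  next
    \<comment> \<open>Here \<open>f\<close> leaves \<open>S\<close>, is a side or the base, or is
      already crossed, so no usable diagonal is lost.\<close>
    case nodiag: False
    note cases = cases[unfolded margin_def]
    have "polygon n m S C (insert f B)"
      using nodiag uv by (intro P.block[OF fC]) (auto simp: doubleton_eq_iff)
    then interpret Q: polygon n m S C "insert f B" .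
    obtain F' where F': "fresh n m S F' (insert f B)" "card F \<le> Suc (card F')"
      using fresh_block[OF F _ le, of u v] uv by auto
    have insideF: "fresh n m S F (insert f B)" if "f = {a, b}" "a \<in> S" "b \<in> S" for a b
      using that uv inside by (auto simp: doubleton_eq_iff)
    show ?thesis
    proof (cases "{0, m} \<in> B")
      case True
      then consider "n + 3 + 2 * card (gaps S C) \<le> card F + 2 * card S"
        | "n + 1 + 2 * card (gaps S C) \<le> 2 * card S" using cases by force
      then show ?thesis
      proof cases
        case 1
        then show ?thesis using Q.reply_fan[OF F'(1)] True F'(2) by auto
      next
        case 2
        then show ?thesis by (rule Q.reply_without_fresh)
      qed
    next
      case free: False
      consider "n + 2 + 2 * card (gaps S C) \<le> card F + 2 * card S"
        | l where "adj S l m" "{l, m} \<notin> C" "{l, m} \<notin> B" "n + 1 + 2 * card (gaps S C) \<le> card F + 2 * card S"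
        | "n + 1 + 2 * card (gaps S C) \<le> 2 * card S" using cases by force
      then show ?thesis
      proof cases
        \<comment> \<open>If Blocker takes the base, no fresh vertex is lost and surplus 2 suffices
          for the fan; otherwise at least 1 remains for a new side.\<close>
        case 1
        show ?thesis
        proof (cases "f = {0, m}")
          case True
          then show ?thesis using Q.reply_fan[OF insideF[OF True P.zero_in P.m_in]] 1 by auto
        next
          case False
          then show ?thesis using Q.reply_side[OF F'(1)] 1 F'(2) free by auto
        qed
      next
        \<comment> \<open>Constructor threatens both to fill the gap and to extend. Blocking the gap
          costs no fresh vertex, so extending works; any other move lets her fill it.\<close>
        case (2 l)
        have "l \<in> S" "l < m" using 2(1) by (auto simp: adj_def)
        have "l \<noteq> 0" using P.spanned[OF 2(1)] 2(2) by auto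
        show ?thesis
        proof (cases "f = {l, m}")
          case True
          then have base: "{0, m} \<notin> insert f B"
            using free \<open>l \<noteq> 0\<close> \<open>l < m\<close> by (auto simp: doubleton_eq_iff)
          show ?thesis by (rule Q.reply_side[OF insideF[OF True \<open>l \<in> S\<close> P.m_in] base 2(4)])
        next
          case ngap: False
          then have open_gap: "{l, m} \<notin> insert f B" using 2(3) by auto
          show ?thesis
          proof (cases "f = {0, m}")
            case True
            show ?thesis
              by (rule Q.reply_fill_gap[OF insideF[OF True P.zero_in P.m_in] 2(1,2) open_gap])
                (use 2(4) in linarith)+
          next
            case False
            show ?thesis
              by (rule Q.reply_fill_gap[OF F'(1) 2(1,2) open_gap])
                (use 2(4) False free F'(2) in auto)
          qed
        qed
      next
        case 3
        then show ?thesis by (rule Q.reply_without_fresh)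
      qed
    qed
  qed
qed

lemma ecb_val_good:
  assumes "good n C B" "k = card (ecb_edges n - C - B)"
  shows "n \<le> 2 * ecb_val n k False C B + 5"
  using assms
proof (induction k arbitrary: C B rule: less_induct)
  case (less k)
  show ?case
  proof (cases "legalC n C B = {}")
    case True
    then have "n \<le> 2 * triangles n C + 5"
      using good_imp_good_reply[OF less.prems(1)] by (auto simp: good_reply_def)
    then show ?thesis using triangles_le_ecb_val[of n C k False B] by linarith
  next
    case False
    then have ne: "ecb_edges n - C - B \<noteq> {}" by (auto simp: legalC_def)
    then have "k \<noteq> 0" using less.prems(2) by simp
    then obtain k1 where k1: "k = Suc k1" using not0_implies_Suc by blast
    define A where "A = (\<lambda>f. ecb_val n k1 True C (insert f B)) ` (ecb_edges n - C - B)"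
    have "Min A \<in> A" unfolding A_def using ne by (intro Min_in) auto
    then obtain f where f: "f \<in> ecb_edges n - C - B" "Min A = ecb_val n k1 True C (insert f B)"
      by (auto simp: A_def)
    have val: "ecb_val n k False C B = ecb_val n k1 True C (insert f B)"
      using False ne f(2) by (simp add: k1 A_def)
    have "ecb_edges n - C - insert f B = (ecb_edges n - C - B) - {f}" by auto
    then have k1_card: "k1 = card (ecb_edges n - C - insert f B)"
      using less.prems(2) f(1) by (simp add: k1)
    from good_reply_Blocker_move[OF less.prems(1) f(1)]
    show ?thesis unfolding good_reply_def
    proof
      assume "n \<le> 2 * triangles n C + 5"
      then show ?thesis using triangles_le_ecb_val[of n C k False B] by linarith
    next
      assume "\<exists>e\<in>legalC n C (insert f B). good n (insert e C) (insert f B)"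
      then obtain e where e: "e \<in> legalC n C (insert f B)" "good n (insert e C) (insert f B)" by blast
      have e': "e \<in> ecb_edges n - C - insert f B" using e(1) by (auto simp: legalC_def)
      then have "k1 \<noteq> 0" using k1_card by auto
      then obtain k2 where k2: "k1 = Suc k2" using not0_implies_Suc by blast
      have "ecb_edges n - insert e C - insert f B = (ecb_edges n - C - insert f B) - {e}" by auto
      then have "k2 = card (ecb_edges n - insert e C - insert f B)" using k1_card k2 e' by simp
      from less.IH[OF _ e(2) this]
      have "n \<le> 2 * ecb_val n k2 False (insert e C) (insert f B) + 5" by (simp add: k1 k2)
      moreover have "ecb_val n k2 False (insert e C) (insert f B) \<le> ecb_val n k1 True C (insert f B)"
        using e(1) by (auto simp: k2 intro!: Max_ge)
      ultimately show ?thesis using val by linarith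
    qed
  qed
qed

section \<open>Opening position and final bounds\<close>

lemma good_start:
  assumes "2 \<le> n" shows "good n {{0, 1}} {}"
proof -
  have "polygon n 1 {0, 1} {{0, 1}} {}"
    by unfold_locales (use assms in \<open>auto simp: noncrossing_def adj_def doubleton_eq_iff\<close>)
  moreover have "fresh n 1 {0, 1} {1<..<n} {}" by (simp add: fresh_def)
  moreover have "gaps {0, 1} {{0, 1}} = {}" by (auto simp: gaps_def adj_def)
  \<comment> \<open>All \<open>n - 2\<close> vertices above 1 are fresh and \<open>S\<close> has two
    vertices: the surplus is exactly 2, with the base not Blocker's.\<close>
  ultimately show ?thesis unfolding good_def margin_def using assms
    by (intro exI[of _ 1] exI[of _ "{0, 1}"] exI[of _ "{1<..<n}"]) auto
qed

lemma g_ECB_K3_lower: "n \<le> 2 * g_ECB_K3 n + 5"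
proof (cases "2 \<le> n")
  case True
  define e where "e = {0, 1 :: nat}"
  have e: "e \<in> legalC n {} {}" using True by (auto simp: legalC_def pair_in_ecb_edges_iff e_def)
  then have "e \<in> ecb_edges n" by (auto simp: legalC_def)
  then have "card (ecb_edges n) \<noteq> 0" by auto
  then obtain k where k: "card (ecb_edges n) = Suc k" using not0_implies_Suc by blast
  have "k = card (ecb_edges n - {e} - {})" using k \<open>e \<in> ecb_edges n\<close> by simp
  then have "n \<le> 2 * ecb_val n k False {e} {} + 5"
    using ecb_val_good good_start[OF True] unfolding e_def by blast
  moreover have "ecb_val n k False {e} {} \<le> g_ECB_K3 n"
    unfolding g_ECB_K3_def k using e by (auto intro!: Max_ge)
  ultimately show ?thesis by linarith
qed simp

theorem theorem1p7:
  shows "\<forall>\<epsilon>>0. \<forall>\<^sub>F n in sequentially.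
     (1 - \<epsilon>) * (real n / 2) \<le> real (g_ECB_K3 n) \<and>
     real (g_ECB_K3 n) \<le> (1 + \<epsilon>) * (2 * real n / 3)"
proof (intro allI impI)
  fix \<epsilon> :: real assume "\<epsilon> > 0"
  \<comment> \<open>With \<epsilon> times \<open>n\<close> at least 5, the additive errors
    \<open>5/2\<close> and \<open>2/3\<close> fit into the relative error.\<close>
  have "\<forall>\<^sub>F n in sequentially. real n \<ge> 5 / \<epsilon>"
    by (rule eventually_compose_filterlim[OF eventually_ge_at_top filterlim_real_sequentially])
  then show "\<forall>\<^sub>F n in sequentially. (1 - \<epsilon>) * (real n / 2) \<le> real (g_ECB_K3 n) \<and>
     real (g_ECB_K3 n) \<le> (1 + \<epsilon>) * (2 * real n / 3)"
  proof eventually_elim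
    case (elim n)
    then have "5 \<le> \<epsilon> * real n" using \<open>\<epsilon> > 0\<close> by (simp add: field_simps)
    moreover have "real n \<le> 2 * real (g_ECB_K3 n) + 5" "3 * real (g_ECB_K3 n) \<le> 2 * real n + 2"
      using g_ECB_K3_lower[of n] g_ECB_K3_upper[of n] by linarith+
    ultimately show ?case by (simp add: algebra_simps)
  qed
qed

end
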